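(* Let $\mathcal{C}$ be a finite set of classes and let $\mathcal{N}$ be a finite set of training samples, partitioned into the sets $\mathcal{N}_c$ ($c\in\mathcal{C}$) of samples belonging to class $c$. For each sample $n\in\mathcal{N}$ let $h_n=(h_{ni})_i$ be its real feature vector and let $p_{nc}$ be the softmax probability the model assigns to class $c\in\mathcal{C}$ for $n$. Define $$\Delta^{\mathrm{grad}}_{ci}=\sum_{n\in\mathcal{N}_c}(1-p_{nc})h_{ni}-\sum_{d\in\mathcal{C}\setminus\{c\}}\ \sum_{n\in\mathcal{N}_d}p_{nc}h_{ni}.$$ Assume (randomly initialised state of the model) that $p_{nc}=\frac{1}{|\mathcal{C}|}$ for all $n\in\mathcal{N}$, $c\in\mathcal{C}$, and that $h_{ni}=\upsilon$ for all $n$ and $i$, where $\upsilon$ is a constant. Then $$\Delta^{\mathrm{grad}}_{ci}\propto|\mathcal{C}|\,|\mathcal{N}_c|-|\mathcal{N}|,$$ that is, $\Delta^{\mathrm{grad}}_{ci}$ equals $|\mathcal{C}||\mathcal{N}_c|-|\mathcal{N}|$ times a factor that does not depend on the class $c$ or the feature index $i$, nor on the sizes $|\mathcal{N}_d|$ ($d\in\mathcal{C}$), i.e. depends only on $\upsilon$ and $|\mathcal{C}|$.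
   Context: The model has a linear classifier with logits $z_{nc}=\sum_i w_{ci}h_{ni}+b_c$, and $p_{nc}=e^{z_{nc}}/\sum_{d\in\mathcal{C}}e^{z_{nd}}$. It is trained with the cross-entropy loss, and $-\Delta^{\mathrm{grad}}_{ci}/|\mathcal{N}|$ is the gradient of the average loss with respect to the weight $w_{ci}$. $|\cdot|$ denotes cardinality. *)

theory Defs
  imports Complex_Main "HOL-Library.Disjoint_Sets"
begin

definition logit ::
  "'i set \<Rightarrow> ('c \<Rightarrow> 'i \<Rightarrow> real) \<Rightarrow> ('c \<Rightarrow> real) \<Rightarrow> ('n \<Rightarrow> 'i \<Rightarrow> real) \<Rightarrow> 'n \<Rightarrow> 'c \<Rightarrow> real" where
  "logit I w b h n c = (\<Sum>i\<in>I. w c i * h n i) + b c"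

definition softmax_prob ::
  "'c set \<Rightarrow> 'i set \<Rightarrow> ('c \<Rightarrow> 'i \<Rightarrow> real) \<Rightarrow> ('c \<Rightarrow> real) \<Rightarrow> ('n \<Rightarrow> 'i \<Rightarrow> real) \<Rightarrow> 'n \<Rightarrow> 'c \<Rightarrow> real" where
  "softmax_prob C I w b h n c = exp (logit I w b h n c) / (\<Sum>d\<in>C. exp (logit I w b h n d))"

text \<open>
  For the cross-entropy loss, \<open>- grad_update C S p h c i / |N|\<close> is the partial derivative of the
  average loss with respect to the weight \<open>w c i\<close>. Here \<open>S c\<close> is the set of samples of class \<open>c\<close>
  and \<open>p n c\<close> the probability assigned to class \<open>c\<close> for sample \<open>n\<close>.
\<close>
definition grad_update ::
  "'c set \<Rightarrow> ('c \<Rightarrow> 'n set) \<Rightarrow> ('n \<Rightarrow> 'c \<Rightarrow> real) \<Rightarrow> ('n \<Rightarrow> 'i \<Rightarrow> real) \<Rightarrow> 'c \<Rightarrow> 'i \<Rightarrow> real" where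
  "grad_update C S p h c i =
     (\<Sum>n\<in>S c. (1 - p n c) * h n i) - (\<Sum>d\<in>C - {c}. \<Sum>n\<in>S d. p n c * h n i)"

end

theory Submission
  imports Defs
begin

text \<open>With constant probability \<open>q\<close> and constant feature value
  \<open>\<upsilon>\<close>, every summand is constant, so the update only counts samples: class
  \<open>c\<close> contributes (1 - q) \<open>\<upsilon>\<close> per sample, every other class takes
  away q \<open>\<upsilon>\<close> per sample. The -q terms of all classes together run over the
  whole partition, leaving \<open>\<upsilon>\<close> (|N_c| - q |N|); this is
  \<open>grad_update_const\<close>. Putting q = 1/|C| and pulling out 1/|C| gives the claimed form
  with factor \<open>\<upsilon>\<close> / |C|.\<close>

lemma grad_update_const:
  assumes "finite C" and fin: "finite (\<Union>d\<in>C. S d)" and disj: "disjoint_family_on S C"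
    and c: "c \<in> C"
    and p: "\<And>n. n \<in> (\<Union>d\<in>C. S d) \<Longrightarrow> p n c = q"
    and h: "\<And>n. n \<in> (\<Union>d\<in>C. S d) \<Longrightarrow> h n i = \<upsilon>"
  shows "grad_update C S p h c i = \<upsilon> * (real (card (S c)) - q * real (card (\<Union>d\<in>C. S d)))"
proof -
  have fin_S: "finite (S d)" if "d \<in> C" for d
    using that fin by (meson UN_upper finite_subset)
  \<comment> \<open>Disjointness makes the class sizes add up to |N|; splitting off class
    \<open>c\<close> then matches the two sums of \<open>grad_update\<close>.\<close>
  have "card (\<Union>d\<in>C. S d) = (\<Sum>d\<in>C. card (S d))"
    using assms(1) fin_S disj by (intro card_UN_disjoint) (auto simp: disjoint_family_on_def)
  also have "\<dots> = card (S c) + (\<Sum>d\<in>C - {c}. card (S d))"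
    using assms(1) c by (rule sum.remove)
  finally have card: "real (card (\<Union>d\<in>C. S d)) = card (S c) + (\<Sum>d\<in>C - {c}. real (card (S d)))"
    by simp
  have own: "(\<Sum>n\<in>S c. (1 - p n c) * h n i) = (\<Sum>n\<in>S c. (1 - q) * \<upsilon>)"
    using c p h by (intro sum.cong) auto
  have other: "(\<Sum>d\<in>C - {c}. \<Sum>n\<in>S d. p n c * h n i) = (\<Sum>d\<in>C - {c}. \<Sum>n\<in>S d. q * \<upsilon>)"
    using p h by (intro sum.cong) auto
  show ?thesis
    unfolding grad_update_def own other card
    by (simp add: sum_distrib_left algebra_simps)
qed

theorem theorem3p1:
  "\<exists>\<kappa> :: real \<Rightarrow> nat \<Rightarrow> real.
     \<forall>(C :: 'c set) (I :: 'i set) (N :: 'n set) (S :: 'c \<Rightarrow> 'n set)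
      (w :: 'c \<Rightarrow> 'i \<Rightarrow> real) (b :: 'c \<Rightarrow> real) (h :: 'n \<Rightarrow> 'i \<Rightarrow> real) (\<upsilon> :: real).
       finite C \<longrightarrow> finite I \<longrightarrow> finite N \<longrightarrow>
       N = (\<Union>c\<in>C. S c) \<longrightarrow> disjoint_family_on S C \<longrightarrow>
       (\<forall>n\<in>N. \<forall>c\<in>C. softmax_prob C I w b h n c = 1 / real (card C)) \<longrightarrow>
       (\<forall>n\<in>N. \<forall>i\<in>I. h n i = \<upsilon>) \<longrightarrow>
       (\<forall>c\<in>C. \<forall>i\<in>I.
          grad_update C S (softmax_prob C I w b h) h c i
            = \<kappa> \<upsilon> (card C) * (real (card C) * real (card (S c)) - real (card N)))"
\<comment> \<open>The witness is fixed before the data are introduced and sees only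
  \<open>\<upsilon>\<close> and |C|, which is what proportionality demands here.\<close>
proof (intro exI[of _ "\<lambda>\<upsilon> k. \<upsilon> / real k"] allI impI ballI)
  fix C :: "'c set" and I :: "'i set" and N :: "'n set" and S :: "'c \<Rightarrow> 'n set"
    and w :: "'c \<Rightarrow> 'i \<Rightarrow> real" and b :: "'c \<Rightarrow> real" and h :: "'n \<Rightarrow> 'i \<Rightarrow> real"
    and \<upsilon> :: real and c i
  assume "finite C" "finite N" "disjoint_family_on S C" "c \<in> C" "i \<in> I"
    and N: "N = (\<Union>c\<in>C. S c)"
    and "\<forall>n\<in>N. \<forall>c\<in>C. softmax_prob C I w b h n c = 1 / real (card C)"
    and "\<forall>n\<in>N. \<forall>i\<in>I. h n i = \<upsilon>"
  then have "grad_update C S (softmax_prob C I w b h) h c i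
      = \<upsilon> * (real (card (S c)) - 1 / real (card C) * real (card N))"
    unfolding N by (intro grad_update_const) auto
  \<comment> \<open>Rewriting |N_c| - |N|/|C| as (|C| |N_c| - |N|)/|C| cancels |C|, which must be
    nonzero; \<open>c\<close> shows that \<open>C\<close> is nonempty.\<close>
  moreover have "card C \<noteq> 0"
    using \<open>finite C\<close> \<open>c \<in> C\<close> by auto
  ultimately show "grad_update C S (softmax_prob C I w b h) h c i
      = \<upsilon> / real (card C) * (real (card C) * real (card (S c)) - real (card N))"
    by (simp add: field_simps)
qed

end
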